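(* Let $(\tau,p)$ be an unbounded probabilistic context tree on a countable alphabet $A$, let $0<\epsilon<1$, and suppose that $(\tau,p)$ has an $\epsilon$-regular reference string $w$ with associated function $\ell^{w}:\mathbb{N}\to\mathbb{N}$. Suppose that $$\limsup_{k\to\infty}\frac{\log(\ell^{w}(k))}{C_{\epsilon}\,k}<1,\qquad C_{\epsilon}:=-\frac{1}{|w|}\log\bigl(1-\epsilon^{|w|}\bigr)>0 .$$ Then for all $m,n$ with $-\infty<m\le n\le+\infty$, $$\mathbb{P}\bigl(\theta[m,n]>-\infty\bigr)=1 ,$$ i.e. the perfect simulation algorithm (which generates $U_m,\ldots,U_n$ and then $U_{m-1},U_{m-2},\ldots$ backward in time until the first $k\le m$ with $\mathcal{L}(U_k^n)=1$, and then constructs the symbols recursively with $F$ from time $k$ to time $n$) stops almost surely after a finite number of steps.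
   Context: Strings: $\mathbb{N}=\{0,1,2,\ldots\}$. For a countable alphabet $A$, $a_m^n$ denotes the string $a_m\ldots a_n$, of length $n-m+1$ (with $a_{n+1}^n=\emptyset$). $A^{-\mathbb{N}}=A^{\{\ldots,-2,-1\}}$ is the set of infinite pasts and $A^\star=\bigcup_{j\ge 0}A^{\{-j,\ldots,-1\}}$ the set of finite strings (including the empty string $\emptyset$). A string $s$ is a suffix of $v$ if $|s|\le|v|$ and $v_{-|s|}^{-1}=s$. Context trees: A tree is a subset $\tau\subset A^\star\cup A^{-\mathbb{N}}$ in which no string is a suffix of another string; it is unbounded if $\sup\{|v|:v\in\tau\}=+\infty$; it is complete (a context tree) if every $a_{-\infty}^{-1}\in A^{-\mathbb{N}}$ has a (necessarily unique) suffix in $\tau$, called its context $c_\tau(a_{-\infty}^{-1})$. For a finite string $a_m^n$, $c_\tau(a_m^n)$ is its suffix belonging to $\tau$ if there is one, and $c_\tau(a_m^n)=\emptyset$ otherwise. A probabilistic context tree $(\tau,p)$ is a context tree $\tau$ with a family $p=\{p(\cdot|v):v\in\tau\}$ of probability distributions on $A$. $\epsilon$-regularity: $a\in A$ is $\epsilon$-regular if $\inf_{v\in\tau}p(a|v)\ge\epsilon$; a finite string is $\epsilon$-regular if all symbols appearing in it are. $\mathcal{E}$ is the (finite) set of $\epsilon$-regular symbols, and $\#\mathcal{E}$ its cardinality. Symbols are labelled so that $A=\{1,2,\ldots\}$ and $\mathcal{E}=\{1,\ldots,\#\mathcal{E}\}$. Reference string: for a nonempty finite string $w$ and $v\in\tau$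 let $m^w(v)=\inf\{j:0\le j\le|v|-|w|,\ v_{-j-|w|}^{-j-1}=w\}$, with $m^w(v)=+\infty$ if there is no such $j$. $w$ is a reference string of $\tau$ with function $\ell^w:\mathbb{N}\to\mathbb{N}$ (finite valued) if $|v|=m^w(v)+|w|+\ell^w(m^w(v))$ for every $v\in\tau$ (so $|v|=+\infty$ exactly when $m^w(v)=+\infty$). Convention: $\log 0=-\infty$. Construction: for $v\in\tau$ and $a\in\mathcal{E}$ let $J(a|\emptyset)=[(a-1)\epsilon,a\epsilon[$, $J(a|v)=\bigl[\#\mathcal{E}\epsilon+\sum_{i=1}^{a-1}(p(i|v)-\epsilon),\ \#\mathcal{E}\epsilon+\sum_{i=1}^{a}(p(i|v)-\epsilon)\bigr[$ and $K(a|v)=J(a|\emptyset)\cup J(a|v)$; for $a\in A\setminus\mathcal{E}$ let $K(a|v)=J(a|v)=\bigl[\sum_{i=1}^{a-1}p(i|v),\sum_{i=1}^{a}p(i|v)\bigr[$. Let $\mathbf{U}=(U_n)_{n\in\mathbb{Z}}$ be i.i.d. uniform on $[0,1[$ under $\mathbb{P}$. The update function $F(u,s)\in A\cup\{\star\}$, for $u\in[0,1[$ and a string $s$ (finite or infinite), is: if $c_\tau(s)\ne\emptyset$, $F(u,s)=a$ for the unique $a\in A$ with $u\in K(a|c_\tau(s))$; if $c_\tau(s)=\emptyset$, $F(u,s)=a$ when $u\in J(a|\emptyset)$, $a\in\mathcal{E}$, and $F(u,s)=\star$ when $u\in[\#\mathcal{E}\epsilon,1[$. For $m\le n\le+\infty$,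 $\mathcal{L}(U_m^n)\in\{0,1\}$ equals $1$ if and only if there is a string $a_m^n$ of symbols of $A$ with $F(U_i,a_m^{i-1})=a_i$ for all $i$ with $m\le i\le n$ ($i<\infty$). Finally $$\theta[m,n]:=\max\{k\le m:\mathcal{L}(U_k^n)=1\},$$ with $\theta[m,n]=-\infty$ if there is no such $k$. *)

theory Defs
  imports "HOL-Probability.Probability" "HOL-Library.Extended"
begin

text \<open>
  The countable alphabet is \<open>A = {1, 2, \<dots>}\<close>, finite or infinite, as a set of natural numbers.
\<close>

definition alphabet :: "nat set \<Rightarrow> bool" where
  "alphabet A \<longleftrightarrow> A = {1..} \<or> (\<exists>N. A = {1..N})"

text \<open>
  \<open>FinStr [a\<^sub>m, \<dots>, a\<^sub>n]\<close> is the finite string in its natural order (most recent symbol last);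
  \<open>InfStr x\<close> is the infinite past whose symbol at time \<open>-(k+1)\<close> is \<open>x k\<close>.
\<close>

datatype symstring = FinStr "nat list" | InfStr "nat \<Rightarrow> nat"

fun slength :: "symstring \<Rightarrow> enat" where
  "slength (FinStr xs) = enat (length xs)"
| "slength (InfStr x) = \<infinity>"

text \<open>\<open>symb v k\<close> is the symbol of \<open>v\<close> at time \<open>-(k+1)\<close>; it is meaningful for \<open>k < |v|\<close> only.\<close>

fun symb :: "symstring \<Rightarrow> nat \<Rightarrow> nat" where
  "symb (FinStr xs) k = rev xs ! k"
| "symb (InfStr x) k = x k"

definition string_over :: "nat set \<Rightarrow> symstring \<Rightarrow> bool" where
  "string_over A v \<longleftrightarrow> (\<forall>k. enat k < slength v \<longrightarrow> symb v k \<in> A)"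

definition is_suffix :: "symstring \<Rightarrow> symstring \<Rightarrow> bool" where
  "is_suffix s v \<longleftrightarrow> slength s \<le> slength v \<and> (\<forall>k. enat k < slength s \<longrightarrow> symb v k = symb s k)"

definition tree :: "nat set \<Rightarrow> symstring set \<Rightarrow> bool" where
  "tree A \<tau> \<longleftrightarrow> (\<forall>v\<in>\<tau>. string_over A v) \<and> (\<forall>s\<in>\<tau>. \<forall>v\<in>\<tau>. s \<noteq> v \<longrightarrow> \<not> is_suffix s v)"

definition complete_tree :: "nat set \<Rightarrow> symstring set \<Rightarrow> bool" where
  "complete_tree A \<tau> \<longleftrightarrow> (\<forall>x. (\<forall>k. x k \<in> A) \<longrightarrow> (\<exists>s\<in>\<tau>. is_suffix s (InfStr x)))"

definition context_tree :: "nat set \<Rightarrow> symstring set \<Rightarrow> bool" where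
  "context_tree A \<tau> \<longleftrightarrow> tree A \<tau> \<and> complete_tree A \<tau>"

definition unbounded_tree :: "symstring set \<Rightarrow> bool" where
  "unbounded_tree \<tau> \<longleftrightarrow> (SUP v\<in>\<tau>. slength v) = \<infinity>"

definition context_of :: "symstring set \<Rightarrow> symstring \<Rightarrow> symstring" where
  "context_of \<tau> s = (if \<exists>v\<in>\<tau>. is_suffix v s then (THE v. v \<in> \<tau> \<and> is_suffix v s) else FinStr [])"

text \<open>
  \<open>p(a|v)\<close> is \<open>pmf (p v) a\<close>; the values of \<open>p\<close> outside \<open>\<tau>\<close> play no role.
\<close>

definition prob_context_tree :: "nat set \<Rightarrow> symstring set \<Rightarrow> (symstring \<Rightarrow> nat pmf) \<Rightarrow> bool" where
  "prob_context_tree A \<tau> p \<longleftrightarrow> context_tree A \<tau> \<and> (\<forall>v\<in>\<tau>. set_pmf (p v) \<subseteq> A)"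

definition regular_symbols ::
  "nat set \<Rightarrow> symstring set \<Rightarrow> (symstring \<Rightarrow> nat pmf) \<Rightarrow> real \<Rightarrow> nat set" where
  "regular_symbols A \<tau> p \<epsilon> = {a \<in> A. (INF v\<in>\<tau>. pmf (p v) a) \<ge> \<epsilon>}"

definition regular_string ::
  "nat set \<Rightarrow> symstring set \<Rightarrow> (symstring \<Rightarrow> nat pmf) \<Rightarrow> real \<Rightarrow> nat list \<Rightarrow> bool" where
  "regular_string A \<tau> p \<epsilon> w \<longleftrightarrow> set w \<subseteq> regular_symbols A \<tau> p \<epsilon>"

text \<open>
  \<open>occurs_at w v j\<close>: \<open>w\<close> occupies the times \<open>-j-|w|, \<dots>, -j-1\<close> of \<open>v\<close>. Its \<open>i\<close>-th symbol from
  the right is then at time \<open>-(j+i+1)\<close>.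
\<close>

definition occurs_at :: "nat list \<Rightarrow> symstring \<Rightarrow> nat \<Rightarrow> bool" where
  "occurs_at w v j \<longleftrightarrow>
     enat (j + length w) \<le> slength v \<and> (\<forall>i<length w. symb v (j + i) = rev w ! i)"

definition last_occ :: "nat list \<Rightarrow> symstring \<Rightarrow> enat" where
  "last_occ w v = (INF j \<in> {j. occurs_at w v j}. enat j)"

definition reference_string ::
  "nat set \<Rightarrow> symstring set \<Rightarrow> nat list \<Rightarrow> (nat \<Rightarrow> nat) \<Rightarrow> bool" where
  "reference_string A \<tau> w l \<longleftrightarrow> w \<noteq> [] \<and> set w \<subseteq> A \<and>
     (\<forall>v\<in>\<tau>. slength v =
        (case last_occ w v of enat j \<Rightarrow> enat (j + length w + l j) | \<infinity> \<Rightarrow> \<infinity>))"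

text \<open>The real logarithm of the library has \<open>ln 0 = 0\<close>, whence the following variant.\<close>

definition elog :: "nat \<Rightarrow> ereal" where
  "elog x = (if x = 0 then - \<infinity> else ereal (ln (real x)))"

definition C_const :: "real \<Rightarrow> nat list \<Rightarrow> real" where
  "C_const \<epsilon> w = - (1 / real (length w)) * ln (1 - \<epsilon> ^ length w)"

definition J_empty :: "real \<Rightarrow> nat \<Rightarrow> real set" where
  "J_empty \<epsilon> a = {(real a - 1) * \<epsilon> ..< real a * \<epsilon>}"

definition J ::
  "nat set \<Rightarrow> symstring set \<Rightarrow> (symstring \<Rightarrow> nat pmf) \<Rightarrow> real \<Rightarrow> nat \<Rightarrow> symstring \<Rightarrow> real set" where
  "J A \<tau> p \<epsilon> a v =
     (let E = regular_symbols A \<tau> p \<epsilon> in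
      if a \<in> E
      then {real (card E) * \<epsilon> + (\<Sum>i\<in>{1..<a}. (pmf (p v) i - \<epsilon>)) ..<
            real (card E) * \<epsilon> + (\<Sum>i\<in>{1..a}. (pmf (p v) i - \<epsilon>))}
      else {(\<Sum>i\<in>{1..<a}. pmf (p v) i) ..< (\<Sum>i\<in>{1..a}. pmf (p v) i)})"

definition K ::
  "nat set \<Rightarrow> symstring set \<Rightarrow> (symstring \<Rightarrow> nat pmf) \<Rightarrow> real \<Rightarrow> nat \<Rightarrow> symstring \<Rightarrow> real set" where
  "K A \<tau> p \<epsilon> a v =
     (if a \<in> regular_symbols A \<tau> p \<epsilon> then J_empty \<epsilon> a \<union> J A \<tau> p \<epsilon> a v else J A \<tau> p \<epsilon> a v)"

text \<open>
  The update function, to be read for \<open>u \<in> {0..<1}\<close>; the value \<open>\<star>\<close> is \<open>None\<close>.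
\<close>

definition update ::
  "nat set \<Rightarrow> symstring set \<Rightarrow> (symstring \<Rightarrow> nat pmf) \<Rightarrow> real \<Rightarrow> real \<Rightarrow> symstring \<Rightarrow> nat option" where
  "update A \<tau> p \<epsilon> u s =
     (if context_of \<tau> s \<noteq> FinStr []
      then Some (THE a. a \<in> A \<and> u \<in> K A \<tau> p \<epsilon> a (context_of \<tau> s))
      else if \<exists>a \<in> regular_symbols A \<tau> p \<epsilon>. u \<in> J_empty \<epsilon> a
      then Some (THE a. a \<in> regular_symbols A \<tau> p \<epsilon> \<and> u \<in> J_empty \<epsilon> a)
      else None)"

text \<open>
  \<open>coalesced \<dots> u m n\<close> is \<open>\<L>(u\<^sub>m\<^sup>n) = 1\<close>. Only the values of \<open>a\<close> at times between \<open>m\<close> and \<open>n\<close>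
  matter; \<open>map a [m..i - 1]\<close> is the string from time \<open>m\<close> to time \<open>i - 1\<close>, empty for \<open>i = m\<close>.
\<close>

definition coalesced ::
  "nat set \<Rightarrow> symstring set \<Rightarrow> (symstring \<Rightarrow> nat pmf) \<Rightarrow> real \<Rightarrow> (int \<Rightarrow> real) \<Rightarrow> int \<Rightarrow> int extended \<Rightarrow> bool"
  where
  "coalesced A \<tau> p \<epsilon> u m n \<longleftrightarrow>
     (\<exists>a :: int \<Rightarrow> nat. \<forall>i. m \<le> i \<and> Fin i \<le> n \<longrightarrow>
        a i \<in> A \<and> update A \<tau> p \<epsilon> (u i) (FinStr (map a [m..i - 1])) = Some (a i))"

definition theta ::
  "nat set \<Rightarrow> symstring set \<Rightarrow> (symstring \<Rightarrow> nat pmf) \<Rightarrow> real \<Rightarrow> (int \<Rightarrow> real) \<Rightarrow> int \<Rightarrow> int extended \<Rightarrow>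
   int extended" where
  "theta A \<tau> p \<epsilon> u m n =
     (if \<exists>k\<le>m. coalesced A \<tau> p \<epsilon> u k n
      then Fin (GREATEST k. k \<le> m \<and> coalesced A \<tau> p \<epsilon> u k n)
      else Minf)"

definition iid_uniform :: "'b measure \<Rightarrow> (int \<Rightarrow> 'b \<Rightarrow> real) \<Rightarrow> bool" where
  "iid_uniform P U \<longleftrightarrow>
     prob_space.indep_vars P (\<lambda>_. borel) U UNIV \<and>
     (\<forall>i. distr P borel (U i) = uniform_measure lborel {0..<1})"

end

theory Submission
  imports Defs
begin

text \<open>
  Write \<open>L\<close> for the length of the reference string \<open>w\<close>. If the variables of \<open>L\<close> consecutive times
  fall into the intervals \<open>J_empty \<epsilon> (w ! i)\<close>, then the simulation writes \<open>w\<close> there, whatever the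
  past is; call such a stretch forced. Once the simulated string contains \<open>w\<close>, its last occurrence
  determines the length of the context: if \<open>j\<close> symbols follow it, then the context has length
  \<open>j + L + l j\<close>, so the next symbol can be computed as soon as the simulated string is that long
  (\<open>context_within\<close>). Hence a simulation never meets a star if forced stretches are frequent enough
  compared with the growth of \<open>l\<close> (\<open>coalesced_if_forced_often\<close>). As such a simulation runs forever,
  this treats all \<open>n\<close> simultaneously, infinite \<open>n\<close> included.

  Cut the time axis into blocks of length \<open>L\<close>. Blocks are forced independently of each other with
  probability \<open>q = \<epsilon> ^ L\<close>, and \<open>C_const \<epsilon> w * L = - ln (1 - q)\<close>. The assumption on the limsup gives
  \<open>c < 1\<close> with \<open>l j \<le> exp (c * C_const \<epsilon> w * j)\<close> for large \<open>j\<close>. Choose \<open>c'\<close> strictly between \<open>c\<close> and \<open>1\<close>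
  and ask, \<open>d\<close> blocks after the start, for a forced block among the last \<open>r d\<close> ones, where
  \<open>r d\<close> is about \<open>ln d / (c' * (- ln (1 - q)))\<close>. At distances below \<open>r d * L\<close> the function \<open>l\<close> is at most
  a constant plus \<open>d powr (c / c')\<close>, which is \<open>o(d)\<close>, so the context fits into the simulated string.
  The request fails with probability \<open>(1 - q) ^ r d\<close>, which is of order \<open>d powr (- 1 / c')\<close> and
  summable (\<open>block_lookback_exists\<close>).

  Summability gives two things. If the first \<open>D\<close> blocks are forced, a union bound shows that all
  requests up to any horizon \<open>T\<close> succeed with probability at least one half; so a given start succeeds
  up to the horizon with probability at least \<open>h = q ^ D / 2\<close>, uniformly in \<open>T\<close>. And the probability
  that some request beyond the horizon fails tends to \<open>0\<close> as \<open>T\<close> grows. Among \<open>M\<close> starts that are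
  \<open>T\<close> blocks apart, the successes up to the horizon are independent, so that no start succeeds forever
  with probability at most \<open>(1 - h) ^ M\<close> plus \<open>M\<close> times the probability of a late failure. Letting
  first \<open>T\<close> and then \<open>M\<close> tend to infinity gives the claim (\<open>recurrent_start_prob_1\<close>).

  The existential quantifier over symbol sequences in \<open>coalesced\<close> ranges over an uncountable set, so
  measurability of the event is not immediate. It holds because the only candidate for the sequence is
  produced by a recursion (\<open>coalesced_iff_simulated\<close>).
\<close>

section \<open>Partition of the unit interval by the update intervals\<close>

lemma mono_cell_exists:
  fixes g :: "nat \<Rightarrow> real"
  assumes "g k \<le> u" and "u < g n"
    and "mono g"
  shows "\<exists>a\<ge>k. a < n \<and> g a \<le> u \<and> u < g (Suc a)"
proof -
  define m where "m = (LEAST i. u < g i)"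
  have m: "u < g m" unfolding m_def using assms(2) by (rule LeastI)
  have mn: "m \<le> n" unfolding m_def using assms(2) by (rule Least_le)
  have "k < m"
    using m assms(1) monoD[OF assms(3), of m k] by (meson le_less_linear less_le_not_le order_trans)
  then obtain a where a: "m = Suc a" "k \<le> a" by (cases m) auto
  have "\<not> u < g a" using a(1) not_less_Least[of a "\<lambda>i. u < g i"] unfolding m_def by auto
  thus ?thesis using a m mn by (intro exI[of _ a]) auto
qed

lemma mono_cell_unique:
  fixes g :: "nat \<Rightarrow> real"
  assumes "mono g" and "g a \<le> u" "u < g (Suc a)" and "g b \<le> u" "u < g (Suc b)"
  shows "a = b"
proof (rule ccontr)
  assume "a \<noteq> b"
  hence "Suc a \<le> b \<or> Suc b \<le> a" by auto
  thus False using assms monoD[OF assms(1), of "Suc a" b] monoD[OF assms(1), of "Suc b" a] by auto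
qed

lemma pmf_partial_sum_exceeds:
  fixes q :: "nat pmf"
  assumes "u < 1" and "pmf q 0 = 0"
  shows "\<exists>n. u < (\<Sum>i\<in>{1..<n}. pmf q i)"
proof -
  have "(\<lambda>n. measure q {..<n}) \<longlonglongrightarrow> measure q (\<Union>n. {..<n})"
    by (rule measure_pmf.finite_Lim_measure_incseq) (auto simp: incseq_def)
  moreover have "(\<Union>n::nat. {..<n}) = UNIV" by auto
  ultimately have "(\<lambda>n. measure q {..<n}) \<longlonglongrightarrow> 1" by simp
  hence "eventually (\<lambda>n. u < measure q {..<n}) sequentially"
    using assms(1) by (rule order_tendstoD)
  then obtain n where n: "u < measure q {..<n}" by (auto simp: eventually_sequentially)
  have "measure q {..<n} = (\<Sum>i<n. pmf q i)" by (simp add: measure_measure_pmf_finite)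
  also have "\<dots> = (\<Sum>i\<in>{1..<n}. pmf q i)"
    using assms(2) by (intro sum.mono_neutral_right) (auto simp: not_le)
  finally show ?thesis using n by metis
qed

text \<open>
  The assumptions on the tree and the reference string alone, without the growth condition and without
  the random variables.
\<close>
locale regular_reference_tree =
  fixes A :: "nat set" and \<tau> :: "symstring set" and p :: "symstring \<Rightarrow> nat pmf"
    and \<epsilon> :: real and w :: "nat list" and l :: "nat \<Rightarrow> nat"
  assumes alph: "alphabet A"
    and pct: "prob_context_tree A \<tau> p"
    and unb: "unbounded_tree \<tau>"
    and eps: "0 < \<epsilon>" "\<epsilon> < 1"
    and initial_regular: "regular_symbols A \<tau> p \<epsilon> = {1..card (regular_symbols A \<tau> p \<epsilon>)}"
    and ref: "reference_string A \<tau> w l"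
    and reg: "regular_string A \<tau> p \<epsilon> w"
begin

abbreviation N :: nat where "N \<equiv> card (regular_symbols A \<tau> p \<epsilon>)"

abbreviation upd :: "real \<Rightarrow> nat list \<Rightarrow> nat option" where
  "upd x s \<equiv> update A \<tau> p \<epsilon> x (FinStr s)"

lemma regular_iff: "a \<in> regular_symbols A \<tau> p \<epsilon> \<longleftrightarrow> 1 \<le> a \<and> a \<le> N"
  using initial_regular by (metis atLeastAtMost_iff)

lemma tree_nonempty: "\<tau> \<noteq> {}"
  using unb by (auto simp: unbounded_tree_def bot_enat_def)

lemma alphabet_pos: "a \<in> A \<Longrightarrow> 1 \<le> a"
  using alph by (auto simp: alphabet_def)

lemma pmf_outside: "v \<in> \<tau> \<Longrightarrow> a \<notin> A \<Longrightarrow> pmf (p v) a = 0"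
  using pct by (auto simp: prob_context_tree_def pmf_eq_0_set_pmf)

lemma one_in_alphabet: "1 \<in> A"
proof -
  obtain v where v: "v \<in> \<tau>" using tree_nonempty by auto
  then obtain a where "a \<in> A"
    using pct set_pmf_not_empty[of "p v"] by (auto simp: prob_context_tree_def)
  thus ?thesis using alph by (auto simp: alphabet_def)
qed

lemma regular_ge:
  assumes "v \<in> \<tau>" and "1 \<le> a" and "a \<le> N"
  shows "\<epsilon> \<le> pmf (p v) a"
proof -
  have "\<epsilon> \<le> (INF v\<in>\<tau>. pmf (p v) a)"
    using regular_iff[of a] assms by (auto simp: regular_symbols_def)
  also have "\<dots> \<le> pmf (p v) a"
    by (rule cINF_lower) (use assms in \<open>auto intro!: bdd_belowI[of _ 0]\<close>)
  finally show ?thesis .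
qed

lemma regular_mass_le_1: "real N * \<epsilon> \<le> 1"
proof -
  obtain v where v: "v \<in> \<tau>" using tree_nonempty by auto
  have "real N * \<epsilon> = (\<Sum>i\<in>{1..N}. \<epsilon>)" by simp
  also have "\<dots> \<le> (\<Sum>i\<in>{1..N}. pmf (p v) i)"
    by (rule sum_mono) (use regular_ge[OF v] in auto)
  also have "\<dots> = measure (p v) {1..N}" by (simp add: measure_measure_pmf_finite)
  also have "\<dots> \<le> 1" by simp
  finally show ?thesis .
qed

lemma empty_notin_tree: "FinStr [] \<notin> \<tau>"
proof
  assume e: "FinStr [] \<in> \<tau>"
  have "v = FinStr []" if "v \<in> \<tau>" for v
    using e that pct by (auto simp: prob_context_tree_def context_tree_def tree_def is_suffix_def zero_enat_def[symmetric])
  hence "\<tau> = {FinStr []}" using e by blast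
  thus False using unb by (simp add: unbounded_tree_def)
qed

lemma is_suffix_linear:
  assumes "is_suffix v s" "is_suffix v' s"
  shows "is_suffix v v' \<or> is_suffix v' v"
proof (cases "slength v \<le> slength v'")
  case True
  thus ?thesis using assms by (fastforce simp: is_suffix_def)
next
  case False
  hence "slength v' \<le> slength v" by simp
  thus ?thesis using assms by (fastforce simp: is_suffix_def)
qed

lemma context_of_eq:
  assumes "v \<in> \<tau>" "is_suffix v s"
  shows "context_of \<tau> s = v"
proof -
  have "(THE v. v \<in> \<tau> \<and> is_suffix v s) = v"
  proof (rule the_equality)
    fix v' assume v': "v' \<in> \<tau> \<and> is_suffix v' s"
    show "v' = v" using is_suffix_linear[of v s v'] v' assms pct
      by (auto simp: prob_context_tree_def context_tree_def tree_def)
  qed (use assms in auto)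
  thus ?thesis using assms by (auto simp: context_of_def)
qed

lemma context_of_cases:
  obtains "context_of \<tau> s = FinStr []" | "context_of \<tau> s \<in> \<tau>" "context_of \<tau> s \<noteq> FinStr []"
proof (cases "\<exists>v\<in>\<tau>. is_suffix v s")
  case True
  then show ?thesis using that context_of_eq empty_notin_tree by metis
next
  case False
  then show ?thesis using that by (auto simp: context_of_def)
qed

text \<open>
  A single formula for the left end points of the intervals \<open>J\<close>: the case distinction between regular and
  other symbols is moved into the summands. All summands are nonnegative, and the right end point of
  \<open>J\<close> at \<open>a\<close> is the left end point at \<open>Suc a\<close>, so that the intervals are the cells of a monotone sequence.
\<close>
definition lower_end :: "symstring \<Rightarrow> nat \<Rightarrow> real" where
  "lower_end v a = real N * \<epsilon> + (\<Sum>i\<in>{1..<a}. pmf (p v) i - (if i \<le> N then \<epsilon> else 0))"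

lemma lower_end_1: "lower_end v 1 = real N * \<epsilon>"
  by (simp add: lower_end_def)

lemma lower_end_beyond:
  assumes "N < a"
  shows "lower_end v a = (\<Sum>i\<in>{1..<a}. pmf (p v) i)"
proof -
  have "(\<Sum>i\<in>{1..<a}. if i \<le> N then \<epsilon> else 0) = (\<Sum>i\<in>{i \<in> {1..<a}. i \<le> N}. \<epsilon>)"
    by (rule sum.inter_filter[symmetric]) simp
  also have "{i \<in> {1..<a}. i \<le> N} = {1..N}" using assms by auto
  finally show ?thesis by (simp add: lower_end_def sum_subtractf)
qed

lemma mono_lower_end: "v \<in> \<tau> \<Longrightarrow> mono (lower_end v)"
  unfolding lower_end_def
  by (intro monoI add_left_mono sum_mono2) (use regular_ge in auto)

lemma J_eq:
  assumes "1 \<le> a"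
  shows "J A \<tau> p \<epsilon> a v = {lower_end v a ..< lower_end v (Suc a)}"
proof (cases "a \<in> regular_symbols A \<tau> p \<epsilon>")
  case True
  hence "a \<le> N" using regular_iff by blast
  hence "lower_end v b = real N * \<epsilon> + (\<Sum>i\<in>{1..<b}. pmf (p v) i - \<epsilon>)" if "b \<le> Suc a" for b
    unfolding lower_end_def using that by (intro arg_cong2[of _ _ _ _ "(+)"] sum.cong) auto
  thus ?thesis using True by (simp add: J_def Let_def atLeastLessThanSuc_atLeastAtMost)
next
  case False
  hence "N < a" using regular_iff assms by auto
  thus ?thesis using False lower_end_beyond[of a v] lower_end_beyond[of "Suc a" v]
    by (simp add: J_def Let_def atLeastLessThanSuc_atLeastAtMost)
qed

text \<open>
  Points below \<open>N * \<epsilon>\<close> are distributed by \<open>J_empty\<close>, the others by the cells of \<open>lower_end\<close>. This reduces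
  uniqueness and existence of the symbol at a given point to the corresponding facts on monotone sequences.
\<close>
lemma mem_K_iff:
  assumes "1 \<le> a" and "v \<in> \<tau>"
  shows "x \<in> K A \<tau> p \<epsilon> a v \<longleftrightarrow>
    (if x < real N * \<epsilon> then a \<le> N \<and> x \<in> J_empty \<epsilon> a
     else lower_end v a \<le> x \<and> x < lower_end v (Suc a))"
proof -
  have "real N * \<epsilon> \<le> lower_end v a"
    using monoD[OF mono_lower_end[OF assms(2)], of 1 a] lower_end_1[of v] assms(1) by simp
  moreover have "x < real N * \<epsilon>" if "a \<le> N" "x \<in> J_empty \<epsilon> a"
  proof -
    have "x < real a * \<epsilon>" using that by (simp add: J_empty_def)
    also have "\<dots> \<le> real N * \<epsilon>" using that eps by (intro mult_right_mono) auto
    finally show ?thesis .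
  qed
  ultimately show ?thesis using regular_iff[of a] assms(1) by (auto simp: K_def J_eq)
qed

lemma J_empty_unique: 
  assumes "x \<in> J_empty \<epsilon> a" "x \<in> J_empty \<epsilon> b"
  shows "a = b"
proof -
  have "mono (\<lambda>n. (real n - 1) * \<epsilon>)"
    using eps by (intro monoI mult_right_mono) auto
  thus ?thesis by (rule mono_cell_unique[of _ a x b]) (use assms in \<open>auto simp: J_empty_def\<close>)
qed

lemma K_unique:
  assumes "v \<in> \<tau>" "a \<in> A" "b \<in> A" "x \<in> K A \<tau> p \<epsilon> a v" "x \<in> K A \<tau> p \<epsilon> b v"
  shows "a = b"
  using assms(4,5) mem_K_iff[OF alphabet_pos assms(1)] assms(2,3) J_empty_unique
    mono_cell_unique[OF mono_lower_end[OF assms(1)], of a x b]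
  by (auto split: if_splits)

lemma K_covers:
  assumes v: "v \<in> \<tau>" and x: "0 \<le> x" "x < 1"
  shows "\<exists>a\<in>A. x \<in> K A \<tau> p \<epsilon> a v"
proof (cases "x < real N * \<epsilon>")
  case True
  have "mono (\<lambda>n. (real n - 1) * \<epsilon>)"
    using eps by (intro monoI mult_right_mono) auto
  then obtain a where a: "1 \<le> a" "a < Suc N" "(real a - 1) * \<epsilon> \<le> x" "x < (real (Suc a) - 1) * \<epsilon>"
    using mono_cell_exists[of "\<lambda>n. (real n - 1) * \<epsilon>" 1 x "Suc N"] True x by auto
  hence "a \<in> A" using regular_iff[of a] by (auto simp: regular_symbols_def)
  moreover have "x \<in> K A \<tau> p \<epsilon> a v"
    using a True by (subst mem_K_iff) (auto simp: v J_empty_def)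
  ultimately show ?thesis by blast
next
  case False
  have "pmf (p v) 0 = 0" using alphabet_pos[of 0] pmf_outside[OF v, of 0] by auto
  then obtain n where "x < (\<Sum>i\<in>{1..<n}. pmf (p v) i)"
    using pmf_partial_sum_exceeds x by blast
  also have "\<dots> \<le> (\<Sum>i\<in>{1..<n + Suc N}. pmf (p v) i)" by (rule sum_mono2) auto
  also have "\<dots> = lower_end v (n + Suc N)" by (rule lower_end_beyond[symmetric]) simp
  finally have "x < lower_end v (n + Suc N)" .
  moreover have "lower_end v 1 \<le> x" using False lower_end_1 by simp
  ultimately obtain a where a: "1 \<le> a" "lower_end v a \<le> x" "x < lower_end v (Suc a)"
    using mono_cell_exists[OF _ _ mono_lower_end[OF v]] by blast
  have "a \<in> A"
  proof (rule ccontr)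
    assume "a \<notin> A"
    hence "N < a" using regular_iff[of a] a(1) by (auto simp: regular_symbols_def)
    moreover have "pmf (p v) a = 0" using pmf_outside[OF v \<open>a \<notin> A\<close>] .
    ultimately have "lower_end v (Suc a) = lower_end v a"
      using a(1) by (simp add: lower_end_beyond)
    thus False using a by simp
  qed
  thus ?thesis using a False by (intro bexI[of _ a]) (auto simp: mem_K_iff v)
qed

lemma update_in_context:
  assumes "v \<in> \<tau>" "is_suffix v (FinStr s)" "0 \<le> x" "x < 1"
  shows "\<exists>a\<in>A. upd x s = Some a"
proof -
  have c: "context_of \<tau> (FinStr s) = v" "v \<noteq> FinStr []"
    using context_of_eq assms empty_notin_tree by auto
  obtain a where a: "a \<in> A" "x \<in> K A \<tau> p \<epsilon> a v" using K_covers assms by blast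
  have "(THE a. a \<in> A \<and> x \<in> K A \<tau> p \<epsilon> a v) = a"
    using a K_unique[OF assms(1)] by (intro the_equality) blast+
  thus ?thesis using a c by (auto simp: update_def)
qed

text \<open>
  A point of \<open>J_empty \<epsilon> a\<close> yields \<open>a\<close> whether or not the past determines a context, as \<open>J_empty \<epsilon> a\<close> is part
  of \<open>K\<close> for every context.
\<close>
lemma update_regular:
  assumes "a \<in> regular_symbols A \<tau> p \<epsilon>" "x \<in> J_empty \<epsilon> a"
  shows "upd x s = Some a"
proof (cases rule: context_of_cases[of "FinStr s"])
  case 1
  have "(THE a. a \<in> regular_symbols A \<tau> p \<epsilon> \<and> x \<in> J_empty \<epsilon> a) = a"
    using assms J_empty_unique by (intro the_equality) blast+
  then show ?thesis using 1 assms by (auto simp: update_def)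
next
  case 2
  let ?v = "context_of \<tau> (FinStr s)"
  have "a \<in> A" "x \<in> K A \<tau> p \<epsilon> a ?v" using assms by (auto simp: K_def regular_symbols_def)
  hence "(THE a. a \<in> A \<and> x \<in> K A \<tau> p \<epsilon> a ?v) = a"
    using K_unique[OF 2(1)] by (intro the_equality) blast+
  then show ?thesis using 2 by (simp add: update_def)
qed

section \<open>Contexts of strings containing the reference string\<close>

lemma w_nonempty: "w \<noteq> []" using ref by (simp add: reference_string_def)

lemma finite_last_occ_occurs:
  assumes "last_occ w v = enat j"
  shows "occurs_at w v j"
proof -
  have "enat ` {j. occurs_at w v j} \<noteq> {}"
  proof
    assume "enat ` {j. occurs_at w v j} = {}"
    hence "last_occ w v = \<infinity>" unfolding last_occ_def by (simp only: Inf_empty top_enat_def)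
    thus False using assms by simp
  qed
  hence "last_occ w v \<in> enat ` {j. occurs_at w v j}"
    unfolding last_occ_def by (metis all_not_in_conv wellorder_InfI)
  thus ?thesis using assms by auto
qed

lemma last_occ_le: "occurs_at w v j \<Longrightarrow> last_occ w v \<le> enat j"
  unfolding last_occ_def by (rule INF_lower) auto

text \<open>
  Extend the string arbitrarily to an infinite past. Completeness supplies a context \<open>v\<close> of the extension.
  It contains an occurrence of \<open>w\<close>, for otherwise it would be infinite and so would contain the one in the
  string. Its last occurrence of \<open>w\<close> is the last one of the string, at a distance \<open>j \<le> j0\<close>, so that
  \<open>v\<close> has length \<open>j + length w + l j\<close> and does not reach into the extension.
  
  The bound is required for all \<open>j \<le> j0\<close> because \<open>w\<close> may occur again after the known occurrence, and
  \<open>l\<close> need not be monotone.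
\<close>
lemma context_within:
  assumes xs: "set xs \<subseteq> A"
    and occ: "occurs_at w (FinStr xs) j0"
    and fits: "\<And>j. j \<le> j0 \<Longrightarrow> j + length w + l j \<le> length xs"
  shows "\<exists>v\<in>\<tau>. is_suffix v (FinStr xs)"
proof -
  define x where "x k = (if k < length xs then rev xs ! k else 1)" for k
  have xA: "x k \<in> A" for k
    using xs one_in_alphabet nth_mem[of k "rev xs"] by (auto simp: x_def)
  then obtain v where v: "v \<in> \<tau>" "is_suffix v (InfStr x)"
    using pct by (auto simp: prob_context_tree_def context_tree_def complete_tree_def) blast
  have sv: "symb v k = x k" if "enat k < slength v" for k
    using v(2) that by (auto simp: is_suffix_def)
  define j where "j = (LEAST j. occurs_at w (FinStr xs) j)"
  have j: "occurs_at w (FinStr xs) j" unfolding j_def using occ by (rule LeastI)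
  have "j \<le> j0" unfolding j_def using occ by (rule Least_le)
  have jlen: "j + length w \<le> length xs" using j by (simp add: occurs_at_def)
  have len: "slength v = (case last_occ w v of enat j \<Rightarrow> enat (j + length w + l j) | \<infinity> \<Rightarrow> \<infinity>)"
    using ref v(1) by (auto simp: reference_string_def)
  have fits_occ: "occurs_at w v j" if "enat (j + length w) \<le> slength v"
    unfolding occurs_at_def
  proof (intro conjI allI impI that)
    fix i assume i: "i < length w"
    have "enat (j + i) < enat (j + length w)" using i by simp
    hence "symb v (j + i) = x (j + i)" using that sv by (meson order_less_le_trans)
    also have "\<dots> = rev w ! i" using j i jlen by (auto simp: occurs_at_def x_def)
    finally show "symb v (j + i) = rev w ! i" .
  qed
  have "last_occ w v = enat j"
  proof (cases "last_occ w v")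
    case infinity
    hence "slength v = \<infinity>" using len by simp
    hence "last_occ w v \<le> enat j" using fits_occ last_occ_le by simp
    thus ?thesis using infinity by simp
  next
    case (enat j')
    hence o: "occurs_at w v j'" by (rule finite_last_occ_occurs)
    have "j \<le> j'"
    proof (rule ccontr)
      assume "\<not> j \<le> j'"
      hence lt: "j' + length w \<le> length xs" using jlen by simp
      have "symb (FinStr xs) (j' + i) = rev w ! i" if "i < length w" for i
      proof -
        have "enat (j' + i) < enat (j' + length w)" using that by simp
        also have "\<dots> \<le> slength v" using o by (simp add: occurs_at_def)
        finally have "symb v (j' + i) = x (j' + i)" by (rule sv)
        thus ?thesis using o that lt by (auto simp: occurs_at_def x_def)
      qed
      hence "occurs_at w (FinStr xs) j'" using lt by (auto simp: occurs_at_def)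
      hence "j \<le> j'" unfolding j_def by (rule Least_le)
      thus False using \<open>\<not> j \<le> j'\<close> by simp
    qed
    hence "enat (j + length w) \<le> enat (j' + length w)" by simp
    also have "\<dots> \<le> slength v" using o by (simp add: occurs_at_def)
    finally have "last_occ w v \<le> enat j" using fits_occ last_occ_le by simp
    thus ?thesis using \<open>j \<le> j'\<close> enat by simp
  qed
  hence "slength v = enat (j + length w + l j)" using len by simp
  moreover have "j + length w + l j \<le> length xs" using fits \<open>j \<le> j0\<close> by simp
  ultimately have "is_suffix v (FinStr xs)"
    using sv by (auto simp: is_suffix_def x_def)
  thus ?thesis using v(1) by blast
qed

section \<open>Coalescence as a property of one recursively built string\<close>

text \<open>
  The string of length \<open>t\<close> built from time \<open>k\<close> on. A star is turned into the unspecified value \<open>the None\<close>,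
  which keeps the recursion total; whether a star occurs is recorded separately in
  \<open>coalesced_iff_simulated\<close>.
\<close>
primrec simulated :: "(int \<Rightarrow> real) \<Rightarrow> int \<Rightarrow> nat \<Rightarrow> nat list" where
  "simulated u k 0 = []"
| "simulated u k (Suc t) = simulated u k t @ [the (upd (u (k + int t)) (simulated u k t))]"

lemma length_simulated [simp]: "length (simulated u k t) = t"
  by (induction t) auto

lemma nth_simulated: "x < t \<Longrightarrow> simulated u k t ! x = the (upd (u (k + int x)) (simulated u k x))"
  by (induction t) (auto simp: nth_append less_Suc_eq)

lemma upto_snoc: "[k..k + int (Suc t) - 1] = [k..k + int t - 1] @ [k + int t]"
  using upto_rec2[of k "k + int t"] by simp

text \<open>
  Each symbol is a function of the preceding ones, so a sequence witnessing coalescence must be the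
  simulated one. This replaces the existential quantifier by a countable conjunction.
\<close>
lemma coalesced_iff_simulated:
  "coalesced A \<tau> p \<epsilon> u k n \<longleftrightarrow>
    (\<forall>t. Fin (k + int t) \<le> n \<longrightarrow> (\<exists>a\<in>A. upd (u (k + int t)) (simulated u k t) = Some a))"
  (is "_ \<longleftrightarrow> ?R")
proof
  assume "coalesced A \<tau> p \<epsilon> u k n"
  then obtain a where a: "\<And>i. k \<le> i \<Longrightarrow> Fin i \<le> n \<Longrightarrow>
      a i \<in> A \<and> upd (u i) (map a [k..i - 1]) = Some (a i)"
    unfolding coalesced_def by blast
  have *: "map a [k..k + int t - 1] = simulated u k t" if "Fin (k + int t) \<le> n" for t
    using that
  proof (induction t)
    case (Suc t)
    have "Fin (k + int t) \<le> n" using Suc.prems by (cases n) auto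
    thus ?case using Suc.IH a[of "k + int t"] by (simp only: upto_snoc map_append) simp
  qed simp
  show ?R
  proof (intro allI impI)
    fix t assume t: "Fin (k + int t) \<le> n"
    show "\<exists>a\<in>A. upd (u (k + int t)) (simulated u k t) = Some a"
      using a[of "k + int t"] t *[OF t] by auto
  qed
next
  assume R: ?R
  define a where "a i = simulated u k (Suc (nat (i - k))) ! nat (i - k)" for i
  have a: "a (k + int t) = the (upd (u (k + int t)) (simulated u k t))" for t
    by (simp add: a_def nth_append)
  have *: "map a [k..k + int t - 1] = simulated u k t" for t
  proof (induction t)
    case (Suc t)
    thus ?case using a[of t] by (simp only: upto_snoc map_append) simp
  qed simp
  show "coalesced A \<tau> p \<epsilon> u k n"
    unfolding coalesced_def
  proof (intro exI[of _ a] allI impI)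
    fix i assume i: "k \<le> i \<and> Fin i \<le> n"
    define t where "t = nat (i - k)"
    have t: "i = k + int t" using i by (simp add: t_def)
    obtain b where "b \<in> A" "upd (u i) (simulated u k t) = Some b" using R i t by blast
    thus "a i \<in> A \<and> upd (u i) (map a [k..i - 1]) = Some (a i)"
      unfolding t using a[of t] *[of t] by simp
  qed
qed

section \<open>Simulations that meet the reference string often\<close>

text \<open>
  The variables at the times \<open>k, \<dots>, k + length w - 1\<close> make every simulation started at or before \<open>k\<close>
  write \<open>w\<close> at these times.
\<close>
definition forced :: "(int \<Rightarrow> real) \<Rightarrow> int \<Rightarrow> bool" where
  "forced u k \<longleftrightarrow> (\<forall>i<length w. u (k + int i) \<in> J_empty \<epsilon> (w ! i))"

lemma w_regular: "i < length w \<Longrightarrow> w ! i \<in> regular_symbols A \<tau> p \<epsilon>"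
  using reg by (auto simp: regular_string_def)

lemma upd_forced:
  assumes "forced u (k + int s)" "i < length w"
  shows "upd (u (k + int (s + i))) xs = Some (w ! i)"
  using assms by (intro update_regular w_regular) (auto simp: forced_def algebra_simps)

lemma forced_occurs:
  assumes "forced u (k + int s)" "s + length w \<le> t"
  shows "occurs_at w (FinStr (simulated u k t)) (t - (s + length w))"
  unfolding occurs_at_def
proof (intro conjI allI impI)
  fix i assume i: "i < length w"
  have "symb (FinStr (simulated u k t)) (t - (s + length w) + i) = simulated u k t ! (s + (length w - 1 - i))"
    using i assms(2) by (simp add: rev_nth)
  also have "\<dots> = w ! (length w - 1 - i)"
  proof -
    have lt: "length w - 1 - i < length w" "s + (length w - 1 - i) < t" using i assms(2) by auto
    show ?thesis unfolding nth_simulated[OF lt(2)] upd_forced[OF assms(1) lt(1)] by simp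
  qed
  finally show "symb (FinStr (simulated u k t)) (t - (s + length w) + i) = rev w ! i"
    using i by (simp add: rev_nth)
qed (use assms in auto)

text \<open>
  The start \<open>k\<close> opens block \<open>0\<close>, and block \<open>d\<close> begins at \<open>k + d * length w\<close>. In the first \<open>D\<close> blocks every
  symbol is written by force. In a later block \<open>d\<close> there is a forced block \<open>e\<close> with \<open>d \<le> e + r d\<close>, whose
  copy of \<open>w\<close> lies at a distance below \<open>r d * length w\<close>; by \<open>fits\<close> the context is then no
  longer than the \<open>d * length w\<close> symbols that are certainly available.
\<close>
lemma coalesced_if_forced_often:
  assumes u: "\<And>i. 0 \<le> u i \<and> u i < 1"
    and init: "\<And>d. d < D \<Longrightarrow> forced u (k + int (d * length w))"
    and later: "\<And>d. D \<le> d \<Longrightarrow> \<exists>e<d. d \<le> e + r d \<and> forced u (k + int (e * length w))"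
    and fits: "\<And>d j. D \<le> d \<Longrightarrow> j < r d * length w \<Longrightarrow> j + length w + l j \<le> d * length w"
  shows "coalesced A \<tau> p \<epsilon> u k n"
proof -
  have step: "\<exists>a\<in>A. upd (u (k + int t)) (simulated u k t) = Some a" if A: "set (simulated u k t) \<subseteq> A" for t
  proof -
    define d where "d = t div length w"
    define i where "i = t mod length w"
    have t: "t = d * length w + i" and i: "i < length w"
      using w_nonempty by (auto simp: d_def i_def)
    show ?thesis
    proof (cases "d < D")
      case True
      have "upd (u (k + int t)) (simulated u k t) = Some (w ! i)"
        using upd_forced[OF init[OF True] i] t by simp
      moreover have "w ! i \<in> A" using w_regular[OF i] by (simp add: regular_symbols_def)
      ultimately show ?thesis by blast
    next
      case False
      then obtain e where e: "e < d" "d \<le> e + r d" "forced u (k + int (e * length w))"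
        using later[of d] by auto
      have le: "e * length w + length w \<le> d * length w"
        using e(1) mult_le_mono1[of "Suc e" d "length w"] by simp
      (* the number of symbols written since the end of block e *)
      define j0 where "j0 = t - (e * length w + length w)"
      have occ: "occurs_at w (FinStr (simulated u k t)) j0"
        unfolding j0_def using forced_occurs[OF e(3)] le t by simp
      have "d * length w \<le> e * length w + r d * length w"
        using mult_le_mono1[OF e(2), of "length w"] by (simp add: add_mult_distrib)
      hence "j0 < r d * length w" using le t i unfolding j0_def by linarith
      hence "j + length w + l j \<le> length (simulated u k t)" if "j \<le> j0" for j
        using fits[of d j] False that t by simp
      then obtain v where "v \<in> \<tau>" "is_suffix v (FinStr (simulated u k t))"
        using context_within[OF A occ] by auto
      thus ?thesis using update_in_context u by auto
    qed
  qed
  have "set (simulated u k t) \<subseteq> A" for t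
  proof (induction t)
    case (Suc t)
    then show ?case using step[OF Suc] by auto
  qed simp
  thus ?thesis using step by (simp add: coalesced_iff_simulated)
qed

section \<open>Measurability of coalescence\<close>

lemma K_borel: 
  assumes "a \<in> A" shows "K A \<tau> p \<epsilon> a v \<in> sets borel"
  using J_eq[OF alphabet_pos[OF assms]] by (simp add: K_def J_empty_def)

text \<open>
  The symbol is selected by \<open>THE\<close> from countably many candidates with Borel conditions, and at most one
  candidate qualifies at each real number.
\<close>
lemma update_measurable: "(\<lambda>x. upd x s) \<in> borel \<rightarrow>\<^sub>M count_space UNIV"
proof (cases rule: context_of_cases[of "FinStr s"])
  case 1
  have [measurable]: "J_empty \<epsilon> a \<in> sets borel" for a by (simp add: J_empty_def)
  have [measurable]: "(\<lambda>x. THE a. a \<in> regular_symbols A \<tau> p \<epsilon> \<and> x \<in> J_empty \<epsilon> a) \<in> borel \<rightarrow>\<^sub>M count_space UNIV"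
    by (rule measurable_THE[where I = UNIV]) (auto intro: J_empty_unique)
  show ?thesis using 1 by (simp add: update_def)
next
  case 2
  let ?v = "context_of \<tau> (FinStr s)"
  have "(\<lambda>x. THE a. a \<in> A \<and> x \<in> K A \<tau> p \<epsilon> a ?v) \<in> borel \<rightarrow>\<^sub>M count_space UNIV"
  proof (rule measurable_THE[where I = UNIV])
    fix a show "Measurable.pred borel (\<lambda>x. a \<in> A \<and> x \<in> K A \<tau> p \<epsilon> a ?v)"
      using K_borel[of a ?v] by (cases "a \<in> A") (auto simp: pred_def)
  qed (auto intro: K_unique[OF 2(1)])
  thus ?thesis using 2 by (simp add: update_def)
qed

text \<open>
  There are only countably many finite strings, so the string of length \<open>t\<close> may be treated as a constant
  when the next symbol is computed.
\<close>
lemma simulated_measurable: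
  assumes U[measurable]: "\<And>i. U i \<in> borel_measurable M"
  shows "(\<lambda>\<omega>. simulated (\<lambda>i. U i \<omega>) k t) \<in> M \<rightarrow>\<^sub>M count_space UNIV"
proof (induction t)
  case (Suc t)
  have "(\<lambda>\<omega>. s @ [the (upd (U (k + int t) \<omega>) s)]) \<in> M \<rightarrow>\<^sub>M count_space UNIV" for s
    using measurable_compose[OF measurable_compose[OF U update_measurable],
        of "\<lambda>y. s @ [the y]" "count_space UNIV" "k + int t" s] by simp
  from measurable_compose_countable[OF this Suc] show ?case by simp
qed simp

lemma coalesced_event:
  assumes U[measurable]: "\<And>i. U i \<in> borel_measurable M"
  shows "{\<omega> \<in> space M. \<exists>k\<le>m. coalesced A \<tau> p \<epsilon> (\<lambda>i. U i \<omega>) k n} \<in> sets M"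
proof -
  have "(\<lambda>\<omega>. upd (U i \<omega>) s) \<in> M \<rightarrow>\<^sub>M count_space UNIV" for i s
    by (rule measurable_compose[OF U update_measurable])
  from measurable_compose_countable[OF this simulated_measurable[OF U]]
  have [measurable]: "(\<lambda>\<omega>. upd (U i \<omega>) (simulated (\<lambda>i. U i \<omega>) k t)) \<in> M \<rightarrow>\<^sub>M count_space UNIV" for i k t .
  show ?thesis unfolding coalesced_iff_simulated by measurable
qed

lemma theta_finite_iff: "theta A \<tau> p \<epsilon> u m n > Minf \<longleftrightarrow> (\<exists>k\<le>m. coalesced A \<tau> p \<epsilon> u k n)"
  by (simp add: theta_def)

end

section \<open>Growth of the reference function\<close>

text \<open>
  The balance behind the growth condition: \<open>r d\<close> must be large enough for \<open>(1 - q) ^ r d\<close> to be summable, and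
  small enough for \<open>l\<close> to be \<open>o(d)\<close> at distances below \<open>r d * L\<close>. With \<open>\<rho> = - ln (1 - q)\<close> and
  \<open>r d\<close> about \<open>ln d / (c' * \<rho>)\<close> the first requirement is \<open>c' < 1\<close> and the second is \<open>c < c'\<close>, where
  \<open>c < 1\<close> is a growth rate of \<open>ln (l k)\<close> relative to \<open>\<rho> * k / L\<close>. The limsup being below \<open>1\<close> leaves
  room for both.
\<close>
lemma block_lookback_exists:
  fixes q :: real and L :: nat and l :: "nat \<Rightarrow> nat"
  assumes q: "0 < q" "q < 1" and L: "0 < L"
    and growth: "limsup (\<lambda>k. elog (l k) / ereal (- (1 / real L) * ln (1 - q) * real k)) < 1"
  shows "\<exists>D r. 1 \<le> D \<and> summable (\<lambda>d. (1 - q) ^ r d) \<and> (\<Sum>d. (1 - q) ^ r (d + D)) \<le> 1/2 \<and>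
    (\<forall>d\<ge>D. 1 \<le> r d \<and> r d \<le> d \<and> (\<forall>j<r d * L. j + L + l j \<le> d * L))"
proof -
  define \<rho> where "\<rho> = - ln (1 - q)"
  have \<rho>: "0 < \<rho>" using q by (simp add: \<rho>_def)
  have e\<rho>: "1 - q = exp (- \<rho>)" using q by (simp add: \<rho>_def)
  obtain c0 :: real where c0: "limsup (\<lambda>k. elog (l k) / ereal (- (1 / real L) * ln (1 - q) * real k)) < ereal c0"
    "ereal c0 < 1" using ereal_dense2[OF growth] by blast
  (* The limsup may be negative, even minus infinity; the rate c is kept positive. *)
  define c where "c = max c0 (1/2)"
  have c: "0 < c" "c < 1" "c0 \<le> c" using c0(2) by (auto simp: c_def)
  have "eventually (\<lambda>k. elog (l k) / ereal (- (1 / real L) * ln (1 - q) * real k) < ereal c0) sequentially"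
    using c0(1) by (rule Limsup_lessD)
  hence "eventually (\<lambda>k. real (l k) \<le> exp (c * \<rho> / L * k)) sequentially"
    using eventually_gt_at_top[of 0]
  proof eventually_elim
    case (elim k)
    show ?case
    proof (cases "l k = 0")
      case False
      have eq: "- (1 / real L) * ln (1 - q) * real k = \<rho> / L * k" by (simp add: \<rho>_def)
      have pos: "0 < \<rho> / L * k" using \<rho> L elim(2) by simp
      have "ln (real (l k)) / (\<rho> / L * k) < c0"
      proof -
        have "elog (l k) / ereal (\<rho> / L * k) = ereal (ln (real (l k)) / (\<rho> / L * k))"
          using False \<rho> L elim(2) by (simp add: elog_def)
        thus ?thesis using elim(1) unfolding eq by simp
      qed
      hence "ln (real (l k)) \<le> c0 * (\<rho> / L * k)" using pos_divide_less_eq[OF pos] less_imp_le by blast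
      also have "\<dots> \<le> c * (\<rho> / L * k)" using c(3) pos by (intro mult_right_mono) auto
      finally have "exp (ln (real (l k))) \<le> exp (c * \<rho> / L * k)" by simp
      thus ?thesis using False by simp
    qed simp
  qed
  then obtain k0 where k0: "\<And>k. k0 \<le> k \<Longrightarrow> real (l k) \<le> exp (c * \<rho> / L * k)"
    by (auto simp: eventually_sequentially)
  (* B absorbs the finitely many values of l before the growth bound sets in. *)
  define B where "B = (\<Sum>j<k0. real (l j))"
  have lB: "real (l k) \<le> B + exp (c * \<rho> / L * k)" for k
  proof (cases "k < k0")
    case True
    hence "real (l k) \<le> B" unfolding B_def by (intro member_le_sum) auto
    thus ?thesis by (simp add: add_increasing2)
  next
    case False
    moreover have "0 \<le> B" by (auto simp: B_def intro: sum_nonneg)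
    ultimately show ?thesis using k0[of k] by simp
  qed
  define c' where "c' = (1 + c) / 2"
  have c': "0 < c'" "c < c'" "c' < 1" using c by (auto simp: c'_def)
  define r where "r d = nat \<lfloor>ln (real d) / (c' * \<rho>)\<rfloor>" for d :: nat
  have r_le: "real (r d) \<le> ln (real d) / (c' * \<rho>)" if "1 \<le> d" for d
    using that c' \<rho> by (simp add: r_def)
  have r_ge: "ln (real d) / (c' * \<rho>) - 1 \<le> real (r d)" for d
    unfolding r_def by linarith
  have summ: "summable (\<lambda>d. (1 - q) ^ r d)"
  proof (rule summable_comparison_test)
    show "summable (\<lambda>d. exp \<rho> * real d powr (- 1 / c'))"
      using c' by (intro summable_mult) (simp add: summable_real_powr_iff field_simps)
    have "(1 - q) ^ r d \<le> exp \<rho> * real d powr (- 1 / c')" if "1 \<le> d" for d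
    proof -
      have "(1 - q) ^ r d = exp (- (real (r d) * \<rho>))" by (simp add: e\<rho> flip: exp_of_nat_mult)
      also have "\<dots> \<le> exp (- ((ln (real d) / (c' * \<rho>) - 1) * \<rho>))"
        using r_ge[of d] \<rho> by simp
      also have "\<dots> = exp (\<rho> + (- 1 / c') * ln (real d))"
        using \<rho> c' by (simp add: field_simps)
      also have "\<dots> = exp \<rho> * real d powr (- 1 / c')"
        using that by (simp add: powr_def flip: exp_add)
      finally show ?thesis .
    qed
    thus "\<exists>N. \<forall>n\<ge>N. norm ((1 - q) ^ r n) \<le> exp \<rho> * real n powr (- 1 / c')"
      using q by (intro exI[of _ 1]) auto
  qed
  define \<kappa> where "\<kappa> = L / (c' * \<rho>)"
  (* An upper bound for j + L + l j at distances j below r d * L, divided by d and with x in place of d. *)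
  have lim0: "((\<lambda>x. \<kappa> * (ln x / x) + (real L + B) * inverse x + x powr (- (1 - c / c'))) \<longlongrightarrow> \<kappa> * 0 + (real L + B) * 0 + 0) at_top"
    using c' by (intro tendsto_intros ln_x_over_x_tendsto_0 tendsto_inverse_0_at_top tendsto_neg_powr filterlim_ident) auto
  have ev1: "eventually (\<lambda>x. \<kappa> * (ln x / x) + (real L + B) * inverse x + x powr (- (1 - c / c')) < 1) at_top"
    by (rule order_tendstoD(2)[OF lim0]) simp
  have "eventually (\<lambda>x::real. c' * \<rho> \<le> ln x) at_top"
    using ln_at_top by (simp add: filterlim_at_top)
  hence "eventually (\<lambda>x. c' * \<rho> \<le> ln x \<and> \<kappa> * ln x + (real L + B) + x powr (c / c') \<le> x) at_top"
    using ev1 eventually_gt_at_top[of 0]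
  proof eventually_elim
    case (elim x)
    have "x * x powr (- (1 - c / c')) = x powr (c / c')"
      using elim(3) by (simp add: powr_diff powr_minus field_simps)
    moreover have "x * (\<kappa> * (ln x / x) + (real L + B) * inverse x + x powr (- (1 - c / c'))) \<le> x * 1"
      using elim by (intro mult_left_mono) auto
    ultimately show ?case using elim(1,3) by (simp add: distrib_left mult.left_commute[of x])
  qed
  hence "eventually (\<lambda>d::nat. c' * \<rho> \<le> ln (real d) \<and> \<kappa> * ln (real d) + (real L + B) + real d powr (c / c') \<le> real d) sequentially"
    by (rule eventually_compose_filterlim[OF _ filterlim_real_sequentially])
  then obtain D1 where D1: "\<And>d. D1 \<le> d \<Longrightarrow> c' * \<rho> \<le> ln (real d) \<and> \<kappa> * ln (real d) + (real L + B) + real d powr (c / c') \<le> real d"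
    by (auto simp: eventually_sequentially)
  obtain D2 where D2: "\<And>n. D2 \<le> n \<Longrightarrow> norm (\<Sum>i. (1 - q) ^ r (i + n)) < 1/2"
    using suminf_exist_split[OF _ summ, of "1/2"] by auto
  define D where "D = max 1 (max D1 D2)"
  have D: "1 \<le> D" "D1 \<le> D" "D2 \<le> D" by (auto simp: D_def)
  have fits: "j + L + l j \<le> d * L" if d: "D \<le> d" and j: "j < r d * L" for d j
  proof -
    have d1: "1 \<le> d" "D1 \<le> d" using D d by auto
    have "real j \<le> real (r d) * L" using j by (metis less_imp_le of_nat_le_iff of_nat_mult)
    also have "\<dots> \<le> ln (real d) / (c' * \<rho>) * L" using r_le[OF d1(1)] by (intro mult_right_mono) auto
    finally have jK: "real j \<le> \<kappa> * ln (real d)" by (simp add: \<kappa>_def mult.commute)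
    have "c * \<rho> / L * real j \<le> c * \<rho> / L * (\<kappa> * ln (real d))"
      using jK c \<rho> by (intro mult_left_mono) auto
    also have "\<dots> = c / c' * ln (real d)" using L \<rho> by (simp add: \<kappa>_def)
    finally have "exp (c * \<rho> / L * real j) \<le> real d powr (c / c')"
      using d1 by (simp add: powr_def)
    hence "real j + L + real (l j) \<le> real d" using D1[OF d1(2)] jK lB[of j] by simp
    also have "\<dots> \<le> real d * L" using L by (simp add: mult_le_cancel_left1)
    finally show ?thesis by (metis of_nat_add of_nat_le_iff of_nat_mult)
  qed
  have rd: "1 \<le> r d \<and> r d \<le> d" if d: "D \<le> d" for d
  proof
    have d1: "1 \<le> d" "D1 \<le> d" using D d by auto
    have "1 \<le> ln (real d) / (c' * \<rho>)" using D1[OF d1(2)] c' \<rho> by simp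
    thus one: "1 \<le> r d" unfolding r_def by linarith
    (* r d is at most d because a window of r d blocks already needs r d * L symbols. *)
    have "r d * L - 1 < r d * L" using one L by simp
    from fits[OF d this] have "r d * L \<le> d * L" using L by linarith
    thus "r d \<le> d" using L by simp
  qed
  have "(\<Sum>d. (1 - q) ^ r (d + D)) \<le> 1/2" using D2[OF D(3)] by simp
  with D(1) summ rd fits show ?thesis by blast
qed

section \<open>Independent trials\<close>

text \<open>
  With trials numbered from a start, some trial among the last \<open>r d\<close> ones before number \<open>d\<close> succeeded. Trials
  before the start do not count.
\<close>
definition recent_success :: "(nat \<Rightarrow> nat) \<Rightarrow> (nat \<Rightarrow> bool) \<Rightarrow> nat \<Rightarrow> bool" where
  "recent_success r f d \<longleftrightarrow> (\<exists>e<d. d \<le> e + r d \<and> f e)"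

context prob_space
begin

lemma indep_pattern_prob:
  fixes F :: "'i \<Rightarrow> 'a \<Rightarrow> bool"
  assumes ind: "indep_vars (\<lambda>_. count_space UNIV) F UNIV"
    and q: "\<And>b. prob {\<omega> \<in> space M. F b \<omega>} = q"
    and fin: "finite X" "finite Y" and disj: "X \<inter> Y = {}"
  shows "prob {\<omega> \<in> space M. (\<forall>b\<in>X. F b \<omega>) \<and> (\<forall>b\<in>Y. \<not> F b \<omega>)} = q ^ card X * (1 - q) ^ card Y"
proof (cases "X \<union> Y = {}")
  case True
  thus ?thesis by (simp add: prob_space)
next
  case False
  have [measurable]: "Measurable.pred M (F b)" for b
    using ind by (auto simp: indep_vars_def)
  let ?A = "\<lambda>i. if i \<in> X then {True} else {False}"
  have T: "prob (F i -` {True} \<inter> space M) = q" for i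
    using q[of i] by (simp add: vimage_def Int_def conj_commute)
  have F: "prob (F i -` {False} \<inter> space M) = 1 - q" for i
  proof -
    have "F i -` {False} \<inter> space M = {\<omega> \<in> space M. \<not> F i \<omega>}" by auto
    moreover have "{\<omega> \<in> space M. F i \<omega>} \<in> events" by measurable
    ultimately show ?thesis using prob_neg q[of i] by simp
  qed
  have "{\<omega> \<in> space M. (\<forall>b\<in>X. F b \<omega>) \<and> (\<forall>b\<in>Y. \<not> F b \<omega>)} = (\<Inter>i\<in>X \<union> Y. {\<omega> \<in> space M. F i \<omega> \<longleftrightarrow> i \<in> X})"
    using False disj by blast
  also have "\<dots> = (\<Inter>i\<in>X \<union> Y. F i -` ?A i \<inter> space M)"
    by (intro INF_cong) auto
  also have "prob \<dots> = (\<Prod>i\<in>X \<union> Y. prob (F i -` ?A i \<inter> space M))"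
    by (rule indep_varsD[OF ind]) (use False fin in auto)
  also have "\<dots> = (\<Prod>i\<in>X. prob (F i -` ?A i \<inter> space M)) * (\<Prod>i\<in>Y. prob (F i -` ?A i \<inter> space M))"
    by (rule prod.union_disjoint[OF fin disj])
  also have "(\<Prod>i\<in>X. prob (F i -` ?A i \<inter> space M)) = (\<Prod>i\<in>X. q)"
    by (intro prod.cong) (auto simp: T)
  also have "(\<Prod>i\<in>Y. prob (F i -` ?A i \<inter> space M)) = (\<Prod>i\<in>Y. 1 - q)"
    using disj F by (intro prod.cong) (auto split: if_splits)
  finally show ?thesis by simp
qed

text \<open>
  \<open>H b0 T\<close> is success of the start \<open>b0\<close> up to the horizon \<open>T\<close>, \<open>late b0 T\<close> a failure beyond it, and \<open>s T\<close> the
  bound on the probability of the latter. The starts \<open>- (j + 1) * T\<close> use disjoint windows of \<open>T\<close> trials up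
  to the horizon, so their successes are independent, whereas late failures only need a union bound.
\<close>
lemma recurrent_start_prob_1:
  fixes F :: "int \<Rightarrow> 'a \<Rightarrow> bool" and r :: "nat \<Rightarrow> nat"
  assumes ind: "indep_vars (\<lambda>_. count_space UNIV) F UNIV"
    and Fq: "\<And>b. prob {\<omega> \<in> space M. F b \<omega>} = q"
    and q: "0 < q" "q < 1"
    and D: "1 \<le> D"
    and summ: "summable (\<lambda>d. (1 - q) ^ r d)"
    and half: "(\<Sum>d. (1 - q) ^ r (d + D)) \<le> 1/2"
    and r: "\<And>d. D \<le> d \<Longrightarrow> 1 \<le> r d \<and> r d \<le> d"
  shows "prob {\<omega> \<in> space M. \<exists>b0\<le>0. (\<forall>d<D. F (b0 + int d) \<omega>) \<and>
            (\<forall>d\<ge>D. recent_success r (\<lambda>e. F (b0 + int e) \<omega>) d)} = 1"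
    (is "prob ?G = 1")
proof -
  have [measurable]: "Measurable.pred M (F b)" for b
    using ind by (auto simp: indep_vars_def)
  define s where "s T = (\<Sum>d. (1 - q) ^ r (d + T))" for T
  have summ_shift: "summable (\<lambda>d. (1 - q) ^ r (d + T))" for T
    using summable_ignore_initial_segment[OF summ] .
  define H where "H b0 T = {\<omega> \<in> space M. (\<forall>d<D. F (b0 + int d) \<omega>) \<and>
      (\<forall>d\<in>{D..<T}. recent_success r (\<lambda>e. F (b0 + int e) \<omega>) d)}" for b0 T
  have [measurable]: "H b0 T \<in> events" for b0 T
    unfolding H_def recent_success_def by measurable
  define c where "c = q ^ D / 2"
  have c: "0 < c" "c \<le> 1" using q power_le_one[of q D] by (auto simp: c_def)

  have H_prob: "c \<le> prob (H b0 T)" for b0 T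
  proof -
    define init where "init = {\<omega> \<in> space M. \<forall>d<D. F (b0 + int d) \<omega>}"
    define bad where "bad d = {\<omega> \<in> init. \<not> recent_success r (\<lambda>e. F (b0 + int e) \<omega>) d}" for d
    have [measurable]: "init \<in> events" "bad d \<in> events" for d
      unfolding init_def bad_def recent_success_def by measurable
    let ?X = "(\<lambda>e. b0 + int e) ` {..<D}"
    have X: "card ?X = D" by (subst card_image) (auto simp: inj_on_def)
    have "init = {\<omega> \<in> space M. (\<forall>b\<in>?X. F b \<omega>) \<and> (\<forall>b\<in>{}. \<not> F b \<omega>)}"
      by (auto simp: init_def)
    hence init_prob: "prob init = q ^ D"
      using indep_pattern_prob[OF ind Fq, of ?X "{}"] X by simp
    (* If the window of request d meets the first D trials, then it contains trial D - 1 and the request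
           cannot fail; otherwise the window is disjoint from the first D trials and hence independent of them. *)
    have bad_prob: "prob (bad d) \<le> q ^ D * (1 - q) ^ r d" if d: "D \<le> d" for d
    proof (cases "d < D + r d")
      case True
      have "D - 1 < d" "d \<le> D - 1 + r d" "D - 1 < D" using True D d by auto
      hence "recent_success r (\<lambda>e. F (b0 + int e) \<omega>) d" if "\<omega> \<in> init" for \<omega>
        using that unfolding init_def recent_success_def by blast
      hence "bad d = {}" by (auto simp: bad_def)
      thus ?thesis using q by simp
    next
      case False
      let ?Y = "(\<lambda>e. b0 + int e) ` {d - r d..<d}"
      have Y: "card ?Y = r d" using False by (subst card_image) (auto simp: inj_on_def)
      have "bad d \<subseteq> {\<omega> \<in> space M. (\<forall>b\<in>?X. F b \<omega>) \<and> (\<forall>b\<in>?Y. \<not> F b \<omega>)}"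
        using False by (auto simp: bad_def init_def recent_success_def)
      hence "prob (bad d) \<le> prob {\<omega> \<in> space M. (\<forall>b\<in>?X. F b \<omega>) \<and> (\<forall>b\<in>?Y. \<not> F b \<omega>)}"
        by (rule finite_measure_mono) measurable
      also have "\<dots> = q ^ card ?X * (1 - q) ^ card ?Y"
        using False by (intro indep_pattern_prob[OF ind Fq]) auto
      finally show ?thesis unfolding X Y .
    qed
    have "(\<Sum>d\<in>{D..<T}. (1 - q) ^ r d) = (\<Sum>i<T - D. (1 - q) ^ r (i + D))"
      by (rule sum.reindex_bij_witness[of _ "\<lambda>i. i + D" "\<lambda>d. d - D"]) auto
    also have "\<dots> \<le> s D"
      unfolding s_def using q by (intro sum_le_suminf summ_shift) auto
    finally have sum_half: "(\<Sum>d\<in>{D..<T}. (1 - q) ^ r d) \<le> 1/2" using half by (simp add: s_def)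
    have "prob (\<Union>d\<in>{D..<T}. bad d) \<le> (\<Sum>d\<in>{D..<T}. prob (bad d))"
      by (rule finite_measure_subadditive_finite) auto
    also have "\<dots> \<le> (\<Sum>d\<in>{D..<T}. q ^ D * (1 - q) ^ r d)"
      using bad_prob by (intro sum_mono) auto
    also have "\<dots> \<le> q ^ D * (1/2)"
      unfolding sum_distrib_left[symmetric] using q sum_half by (intro mult_left_mono) auto
    finally have "prob (\<Union>d\<in>{D..<T}. bad d) \<le> q ^ D / 2" by simp
    moreover have "prob init \<le> prob (H b0 T \<union> (\<Union>d\<in>{D..<T}. bad d))"
    proof (intro finite_measure_mono subsetI)
      fix \<omega> assume i: "\<omega> \<in> init"
      show "\<omega> \<in> H b0 T \<union> (\<Union>d\<in>{D..<T}. bad d)"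
      proof (cases "\<exists>d\<in>{D..<T}. \<omega> \<in> bad d")
        case False
        hence "\<omega> \<in> H b0 T" using i unfolding init_def bad_def H_def by blast
        thus ?thesis by blast
      qed blast
    qed measurable
    moreover have "\<dots> \<le> prob (H b0 T) + prob (\<Union>d\<in>{D..<T}. bad d)"
      by (rule measure_Un_le) auto
    ultimately show ?thesis using init_prob by (simp add: c_def)
  qed

  have H_indep: "prob {\<omega> \<in> space M. \<forall>j<n. \<omega> \<notin> H (- int ((j + 1) * T)) T} \<le> (1 - c) ^ n"
    if T: "D \<le> T" for n T
  proof -
    define b where "b j = - int ((j + 1) * T)" for j
    define Kb where "Kb j = {b j..<b j + int T}" for j
    define Y where "Y j f \<longleftrightarrow> (\<forall>d<D. f (b j + int d)) \<and>
      (\<forall>d\<in>{D..<T}. recent_success r (\<lambda>e. f (b j + int e)) d)" for j and f :: "int \<Rightarrow> bool"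
    define R where "R j \<omega> = restrict (\<lambda>i. F i \<omega>) (Kb j)" for j \<omega>
    have "disjoint_family Kb"
    proof -
      have "Kb i \<inter> Kb j = {}" if "i < j" for i j
      proof -
        have "int (i + 2) * int T \<le> int (j + 1) * int T" using that by (intro mult_right_mono) auto
        thus ?thesis by (auto simp: Kb_def b_def algebra_simps)
      qed
      thus ?thesis unfolding disjoint_family_on_def by (metis Int_commute nat_neq_iff)
    qed
    hence "indep_vars (\<lambda>j. PiM (Kb j) (\<lambda>_. count_space UNIV)) R UNIV"
      unfolding R_def by (intro indep_vars_restrict[OF ind]) auto
    moreover have Y_meas: "Y j \<in> PiM (Kb j) (\<lambda>_. count_space UNIV) \<rightarrow>\<^sub>M count_space UNIV" for j
    proof -
      (* Off Kb j the functions in the product space take the fixed value undefined. *)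
      have [measurable]: "Measurable.pred (PiM (Kb j) (\<lambda>_. count_space UNIV)) (\<lambda>f. f i)" for i :: int
      proof (cases "i \<in> Kb j")
        case False
        hence "(\<lambda>f. f i) \<in> PiM (Kb j) (\<lambda>_. count_space UNIV) \<rightarrow>\<^sub>M (count_space UNIV :: bool measure) \<longleftrightarrow>
            (\<lambda>f. undefined) \<in> PiM (Kb j) (\<lambda>_. count_space UNIV :: bool measure) \<rightarrow>\<^sub>M (count_space UNIV :: bool measure)"
          by (intro measurable_cong) (auto simp: space_PiM PiE_def extensional_def)
        thus ?thesis by simp
      qed simp
      show ?thesis unfolding Y_def recent_success_def by measurable
    qed
    ultimately have indY: "indep_vars (\<lambda>_. count_space UNIV) (\<lambda>j \<omega>. Y j (R j \<omega>)) UNIV"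
      by (rule indep_vars_compose2)
    have YR: "{\<omega> \<in> space M. Y j (R j \<omega>)} = H (b j) T" for j
    proof -
      have val: "R j \<omega> (b j + int e) = F (b j + int e) \<omega>" if "e < T" for e \<omega>
        using that by (simp add: R_def Kb_def)
      have "recent_success r (\<lambda>e. R j \<omega> (b j + int e)) d = recent_success r (\<lambda>e. F (b j + int e) \<omega>) d"
        if "d < T" for d \<omega>
        unfolding recent_success_def using that by (intro ex_cong1) (auto simp: val)
      moreover have "R j \<omega> (b j + int d) = F (b j + int d) \<omega>" if "d < D" for d \<omega>
        using that T by (intro val) simp
      ultimately show ?thesis unfolding Y_def H_def by (intro Collect_cong conj_cong refl) auto
    qed
    have notY: "(\<lambda>\<omega>. Y j (R j \<omega>)) -` {False} \<inter> space M = space M - H (b j) T" for j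
      unfolding YR[symmetric] by auto
    show ?thesis
    proof (cases "n = 0")
      case False
      have "{\<omega> \<in> space M. \<forall>j<n. \<omega> \<notin> H (b j) T} = (\<Inter>j\<in>{..<n}. (\<lambda>\<omega>. Y j (R j \<omega>)) -` {False} \<inter> space M)"
        using False unfolding notY by auto
      also have "prob \<dots> = (\<Prod>j\<in>{..<n}. prob ((\<lambda>\<omega>. Y j (R j \<omega>)) -` {False} \<inter> space M))"
        using False by (intro indep_varsD[OF indY]) auto
      also have "\<dots> \<le> (\<Prod>j\<in>{..<n}. 1 - c)"
        unfolding notY using H_prob by (intro prod_mono) (auto simp: prob_compl)
      finally show ?thesis by (simp add: b_def)
    qed simp
  qed

  define late where "late b0 T = {\<omega> \<in> space M. \<exists>d. \<not> recent_success r (\<lambda>e. F (b0 + int e) \<omega>) (d + T)}" for b0 T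
  have [measurable]: "late b0 T \<in> events" for b0 T
    unfolding late_def recent_success_def by measurable
  have late_prob: "prob (late b0 T) \<le> s T" if T: "D \<le> T" for b0 T
  proof -
    define bad where "bad d = {\<omega> \<in> space M. \<not> recent_success r (\<lambda>e. F (b0 + int e) \<omega>) (d + T)}" for d
    have [measurable]: "bad d \<in> events" for d
      unfolding bad_def recent_success_def by measurable
    have bad_events: "range bad \<subseteq> events" by (intro image_subsetI) measurable
    have bad_prob: "prob (bad d) \<le> (1 - q) ^ r (d + T)" for d
    proof -
      let ?d = "d + T"
      have rd: "r ?d \<le> ?d" using r[of ?d] T by simp
      let ?Y = "(\<lambda>e. b0 + int e) ` {?d - r ?d..<?d}"
      have Y: "card ?Y = r ?d" using rd by (subst card_image) (auto simp: inj_on_def)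
      have "bad d \<subseteq> {\<omega> \<in> space M. (\<forall>b\<in>{}. F b \<omega>) \<and> (\<forall>b\<in>?Y. \<not> F b \<omega>)}"
        by (auto simp: bad_def recent_success_def)
      hence "prob (bad d) \<le> prob {\<omega> \<in> space M. (\<forall>b\<in>{}. F b \<omega>) \<and> (\<forall>b\<in>?Y. \<not> F b \<omega>)}"
        by (rule finite_measure_mono) measurable
      also have "\<dots> = q ^ card ({} :: int set) * (1 - q) ^ card ?Y"
        by (intro indep_pattern_prob[OF ind Fq]) auto
      finally show ?thesis using Y by simp
    qed
    have sb: "summable (\<lambda>d. prob (bad d))"
      using bad_prob by (intro summable_comparison_test'[OF summ_shift[of T]]) auto
    have "late b0 T = (\<Union>d. bad d)" by (auto simp: late_def bad_def)
    hence "prob (late b0 T) \<le> (\<Sum>d. prob (bad d))"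
      using finite_measure_subadditive_countably[OF bad_events sb] by simp
    also have "\<dots> \<le> s T" unfolding s_def by (intro suminf_le bad_prob sb summ_shift)
    finally show ?thesis .
  qed

  define G where "G = ?G"
  have [measurable]: "G \<in> events" unfolding G_def recent_success_def by measurable
  have bound: "1 \<le> prob G + (1 - c) ^ n + real n * s T" if T: "D \<le> T" for n T
  proof -
    define b where "b j = - int ((j + 1) * T)" for j
    define N where "N = {\<omega> \<in> space M. \<forall>j<n. \<omega> \<notin> H (b j) T}"
    define L where "L = (\<Union>j\<in>{..<n}. late (b j) T)"
    have [measurable]: "N \<in> events" "L \<in> events" unfolding N_def L_def by measurable
    have "space M \<subseteq> G \<union> N \<union> L"
    proof
      fix \<omega> assume w: "\<omega> \<in> space M"
      show "\<omega> \<in> G \<union> N \<union> L"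
      proof (cases "\<omega> \<in> N \<union> L")
        case False
        then obtain j where j: "j < n" "\<omega> \<in> H (b j) T" "\<omega> \<notin> late (b j) T" using w by (auto simp: N_def L_def)
        have "recent_success r (\<lambda>e. F (b j + int e) \<omega>) d" if "D \<le> d" for d
        proof (cases "d < T")
          case False
          hence "d = (d - T) + T" by simp
          thus ?thesis using j(3) w unfolding late_def by (metis (mono_tags, lifting) mem_Collect_eq)
        qed (use j(2) that in \<open>auto simp: H_def\<close>)
        moreover have "b j \<le> 0" unfolding b_def neg_le_0_iff_le by (rule of_nat_0_le_iff)
        ultimately have "\<omega> \<in> G" using j(2) w unfolding G_def H_def by blast
        thus ?thesis by blast
      qed blast
    qed
    hence "1 \<le> prob (G \<union> N \<union> L)"
      using finite_measure_mono[of "space M" "G \<union> N \<union> L"] by (simp add: prob_space)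
    also have "\<dots> \<le> prob (G \<union> N) + prob L" by (rule measure_Un_le) auto
    also have "prob (G \<union> N) \<le> prob G + prob N" by (rule measure_Un_le) auto
    also have "prob N \<le> (1 - c) ^ n" using H_indep[OF T] unfolding N_def b_def .
    also have "prob L \<le> (\<Sum>j\<in>{..<n}. prob (late (b j) T))"
      unfolding L_def by (rule finite_measure_subadditive_finite) auto
    also have "\<dots> \<le> (\<Sum>j\<in>{..<n}. s T)" by (intro sum_mono late_prob[OF T])
    finally show ?thesis by simp
  qed

  have "1 \<le> prob G"
  proof (rule field_le_epsilon)
    fix e :: real assume e: "0 < e"
    have "0 \<le> 1 - c" "1 - c < 1" using c by auto
    then obtain n where n: "(1 - c) ^ n < e / 2"
      using real_arch_pow_inv[of "e/2" "1 - c"] e by auto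
    (* The horizon is chosen after n, so that n late failures together have probability at most e / 2. *)
    obtain T0 where T0: "\<And>T. T0 \<le> T \<Longrightarrow> norm (s T) < e / (2 * (real n + 1))"
      using suminf_exist_split[OF _ summ, of "e / (2 * (real n + 1))"] e unfolding s_def by auto
    define T where "T = max D T0"
    have "s T < e / (2 * (real n + 1))" using T0[of T] by (simp add: T_def)
    hence "real n * s T \<le> real n * (e / (2 * (real n + 1)))" by (intro mult_left_mono) auto
    also have "\<dots> \<le> e / 2" using e by (simp add: field_simps)
    finally show "1 \<le> prob G + e" using bound[of T n] n by (simp add: T_def)
  qed
  thus ?thesis using prob_le_1[of G] unfolding G_def by linarith
qed

end

section \<open>The uniform variables\<close>

lemma iid_uniform_measurable:
  assumes "prob_space P" "iid_uniform P U"
  shows "U i \<in> borel_measurable P"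
  using assms by (auto simp: iid_uniform_def prob_space.indep_vars_def)

lemma iid_uniform_AE_unit:
  assumes "prob_space P" "iid_uniform P U"
  shows "AE \<omega> in P. \<forall>i. 0 \<le> U i \<omega> \<and> U i \<omega> < 1"
proof -
  have "AE \<omega> in P. 0 \<le> U i \<omega> \<and> U i \<omega> < 1" for i
  proof (rule AE_distrD[OF iid_uniform_measurable[OF assms]])
    have d: "distr P borel (U i) = uniform_measure lborel {0..<1}"
      using assms(2) by (simp add: iid_uniform_def)
    show "AE x in distr P borel (U i). 0 \<le> x \<and> x < 1"
      unfolding d by (rule AE_uniform_measureI) auto
  qed
  thus ?thesis by (simp add: AE_all_countable)
qed

lemma iid_uniform_interval_prob:
  assumes "prob_space P" "iid_uniform P U" and "0 \<le> a" "a \<le> b" "b \<le> 1"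
  shows "measure P (U i -` {a..<b} \<inter> space P) = b - a"
proof -
  have "measure P (U i -` {a..<b} \<inter> space P) = measure (distr P borel (U i)) {a..<b}"
    by (rule measure_distr[symmetric]) (simp_all add: iid_uniform_measurable[OF assms(1,2)])
  also have "\<dots> = measure (uniform_measure lborel {0..<1}) {a..<b}"
    using assms(2) by (simp add: iid_uniform_def)
  also have "\<dots> = measure lborel ({0..<1} \<inter> {a..<b}) / measure lborel {0..<1::real}"
    by (rule measure_uniform_measure) auto
  also have "{0..<1} \<inter> {a..<b} = {a..<b}" using assms by auto
  finally show ?thesis using assms by simp
qed

context regular_reference_tree
begin

text \<open>
  Each of the intervals \<open>J_empty \<epsilon> (w ! i)\<close> has length \<open>\<epsilon>\<close> and lies in the unit interval, because \<open>N\<close> symbols of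
  probability at least \<open>\<epsilon>\<close> leave \<open>N * \<epsilon> \<le> 1\<close>.
\<close>
lemma forced_prob:
  assumes P: "prob_space P" and U: "iid_uniform P U"
  shows "measure P {\<omega> \<in> space P. forced (\<lambda>i. U i \<omega>) k} = \<epsilon> ^ length w"
proof -
  interpret prob_space P by fact
  have ind: "indep_vars (\<lambda>_. borel) U UNIV" using U by (simp add: iid_uniform_def)
  let ?J = "(\<lambda>i. k + int i) ` {..<length w}"
  let ?S = "\<lambda>i. U (k + int i) -` J_empty \<epsilon> (w ! i) \<inter> space P"
  have one: "prob (?S i) = \<epsilon>" if i: "i < length w" for i
  proof -
    have a: "1 \<le> w ! i" "w ! i \<le> N" using w_regular[OF i] regular_iff by blast+
    have "real (w ! i) * \<epsilon> \<le> real N * \<epsilon>" using a eps by (intro mult_right_mono) auto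
    hence "real (w ! i) * \<epsilon> \<le> 1" using regular_mass_le_1 by linarith
    hence "prob (?S i) = real (w ! i) * \<epsilon> - (real (w ! i) - 1) * \<epsilon>"
      unfolding J_empty_def using a eps
      by (intro iid_uniform_interval_prob[OF P U]) (auto simp: algebra_simps)
    thus ?thesis by (simp add: algebra_simps)
  qed
  have "{\<omega> \<in> space P. forced (\<lambda>i. U i \<omega>) k} = (\<Inter>i\<in>{..<length w}. ?S i)"
    using w_nonempty by (auto simp: forced_def)
  also have "\<dots> = (\<Inter>x\<in>?J. U x -` J_empty \<epsilon> (w ! nat (x - k)) \<inter> space P)" by simp
  also have "prob \<dots> = (\<Prod>x\<in>?J. prob (U x -` J_empty \<epsilon> (w ! nat (x - k)) \<inter> space P))"
    using w_nonempty by (intro indep_varsD[OF ind]) (auto simp: J_empty_def)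
  also have "\<dots> = (\<Prod>i<length w. prob (?S i))"
    by (subst prod.reindex) (auto simp: inj_on_def)
  also have "\<dots> = (\<Prod>i<length w. \<epsilon>)" by (intro prod.cong one) auto
  finally show ?thesis by simp
qed

lemma forced_indep:
  assumes P: "prob_space P" and U: "iid_uniform P U"
  shows "prob_space.indep_vars P (\<lambda>_. count_space UNIV)
    (\<lambda>b \<omega>. forced (\<lambda>i. U i \<omega>) (m + b * int (length w))) UNIV"
proof -
  interpret prob_space P by fact
  have ind: "indep_vars (\<lambda>_. borel) U UNIV" using U by (simp add: iid_uniform_def)
  define k where "k b = m + b * int (length w)" for b
  define Kb where "Kb b = {k b..<k b + int (length w)}" for b
  have "disjoint_family Kb"
  proof -
    have "Kb i \<inter> Kb j = {}" if "i < j" for i j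
    proof -
      have "(i + 1) * int (length w) \<le> j * int (length w)" using that by (intro mult_right_mono) auto
      thus ?thesis by (auto simp: Kb_def k_def algebra_simps)
    qed
    thus ?thesis unfolding disjoint_family_on_def by (metis Int_commute linorder_neq_iff)
  qed
  hence "indep_vars (\<lambda>b. PiM (Kb b) (\<lambda>_. borel)) (\<lambda>b \<omega>. restrict (\<lambda>i. U i \<omega>) (Kb b)) UNIV"
    by (intro indep_vars_restrict[OF ind]) auto
  moreover have "(\<lambda>f. forced f (k b)) \<in> PiM (Kb b) (\<lambda>_. borel) \<rightarrow>\<^sub>M count_space UNIV" for b
  proof -
    have "Measurable.pred (PiM (Kb b) (\<lambda>_. borel)) (\<lambda>f. f (k b + int i) \<in> J_empty \<epsilon> (w ! i))"
      if "i \<in> {..<length w}" for i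
    proof -
      have [measurable]: "(\<lambda>f. f (k b + int i)) \<in> PiM (Kb b) (\<lambda>_. borel) \<rightarrow>\<^sub>M (borel :: real measure)"
        using that by (intro measurable_component_singleton) (auto simp: Kb_def)
      have [measurable]: "J_empty \<epsilon> (w ! i) \<in> sets borel" by (simp add: J_empty_def)
      show ?thesis by measurable
    qed
    hence "Measurable.pred (PiM (Kb b) (\<lambda>_. borel)) (\<lambda>f. \<forall>i\<in>{..<length w}. f (k b + int i) \<in> J_empty \<epsilon> (w ! i))"
      by (intro pred_intros_finite) auto
    moreover have "(\<lambda>f. forced f (k b)) = (\<lambda>f. \<forall>i\<in>{..<length w}. f (k b + int i) \<in> J_empty \<epsilon> (w ! i))"
      by (intro ext) (simp add: forced_def Ball_def)
    ultimately show ?thesis by simp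
  qed
  ultimately have "indep_vars (\<lambda>_. count_space UNIV) (\<lambda>b \<omega>. forced (restrict (\<lambda>i. U i \<omega>) (Kb b)) (k b)) UNIV"
    by (rule indep_vars_compose2)
  moreover have "forced (restrict (\<lambda>i. U i \<omega>) (Kb b)) (k b) = forced (\<lambda>i. U i \<omega>) (k b)" for b \<omega>
    by (simp add: forced_def Kb_def)
  ultimately show ?thesis unfolding k_def by simp
qed

end

section \<open>Almost sure termination\<close>

theorem theorem5p1:
  fixes A :: "nat set" and \<tau> :: "symstring set" and p :: "symstring \<Rightarrow> nat pmf"
    and \<epsilon> :: real and w :: "nat list" and l :: "nat \<Rightarrow> nat"
    and P :: "'b measure" and U :: "int \<Rightarrow> 'b \<Rightarrow> real"
    and m :: int and n :: "int extended"
  assumes "alphabet A"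
    and "prob_context_tree A \<tau> p"
    and "unbounded_tree \<tau>"
    and "0 < \<epsilon>" and "\<epsilon> < 1"
    and "regular_symbols A \<tau> p \<epsilon> = {1..card (regular_symbols A \<tau> p \<epsilon>)}"
    and "reference_string A \<tau> w l"
    and "regular_string A \<tau> p \<epsilon> w"
    and "limsup (\<lambda>k. elog (l k) / ereal (C_const \<epsilon> w * real k)) < 1"
    and "prob_space P"
    and "iid_uniform P U"
    and "Fin m \<le> n"
  shows "measure P {\<omega> \<in> space P. theta A \<tau> p \<epsilon> (\<lambda>i. U i \<omega>) m n > Minf} = 1"
proof -
  interpret regular_reference_tree A \<tau> p \<epsilon> w l by unfold_locales fact+
  interpret prob_space P by fact
  note P = \<open>prob_space P\<close> and U = \<open>iid_uniform P U\<close>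
  define q where "q = \<epsilon> ^ length w"
  have len: "0 < length w" using w_nonempty by simp
  have q: "0 < q" "q < 1"
    using eps len by (auto simp: q_def power_less_one_iff)
  have growth: "limsup (\<lambda>k. elog (l k) / ereal (- (1 / real (length w)) * ln (1 - q) * real k)) < 1"
    using assms(9) by (simp only: C_const_def q_def)
  obtain D :: nat and r :: "nat \<Rightarrow> nat" where D: "1 \<le> D" and summ: "summable (\<lambda>d. (1 - q) ^ r d)"
    and half: "(\<Sum>d. (1 - q) ^ r (d + D)) \<le> 1/2"
    and r: "\<And>d. D \<le> d \<Longrightarrow> 1 \<le> r d \<and> r d \<le> d"
    and fits: "\<And>d j. D \<le> d \<Longrightarrow> j < r d * length w \<Longrightarrow> j + length w + l j \<le> d * length w"
    using block_lookback_exists[OF q len growth] by blast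
  define F where "F b \<omega> = forced (\<lambda>i. U i \<omega>) (m + b * int (length w))" for b \<omega>
  define G where "G = {\<omega> \<in> space P. \<exists>b0\<le>0. (\<forall>d<D. F (b0 + int d) \<omega>) \<and>
      (\<forall>d\<ge>D. recent_success r (\<lambda>e. F (b0 + int e) \<omega>) d)}"
  define E where "E = {\<omega> \<in> space P. \<exists>k\<le>m. coalesced A \<tau> p \<epsilon> (\<lambda>i. U i \<omega>) k n}"
  have "prob G = 1"
    unfolding G_def by (rule recurrent_start_prob_1[OF _ _ q D summ half r])
      (use forced_indep[OF P U, of m] forced_prob[OF P U] in \<open>simp_all add: F_def[abs_def] q_def\<close>)
  moreover have "prob G \<le> prob E"
  proof (rule finite_measure_mono_AE)
    show "E \<in> events" unfolding E_def by (intro coalesced_event iid_uniform_measurable[OF P U])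
    show "AE \<omega> in P. \<omega> \<in> G \<longrightarrow> \<omega> \<in> E"
      using iid_uniform_AE_unit[OF P U]
    proof eventually_elim
      case (elim \<omega>)
      show ?case
      proof
        assume "\<omega> \<in> G"
        then obtain b0 where w: "\<omega> \<in> space P" and b0: "b0 \<le> 0"
          and init: "\<And>d. d < D \<Longrightarrow> F (b0 + int d) \<omega>"
          and later: "\<And>d. D \<le> d \<Longrightarrow> recent_success r (\<lambda>e. F (b0 + int e) \<omega>) d"
          unfolding G_def by blast
        define k where "k = m + b0 * int (length w)"
        have F: "F (b0 + int d) \<omega> \<longleftrightarrow> forced (\<lambda>i. U i \<omega>) (k + int (d * length w))" for d
          by (simp add: F_def k_def algebra_simps)
        have "coalesced A \<tau> p \<epsilon> (\<lambda>i. U i \<omega>) k n"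
        proof (rule coalesced_if_forced_often[OF _ _ _ fits])
          show "0 \<le> U i \<omega> \<and> U i \<omega> < 1" for i using elim by blast
          show "forced (\<lambda>i. U i \<omega>) (k + int (d * length w))" if "d < D" for d
            using init[OF that] F by blast
          show "\<exists>e<d. d \<le> e + r d \<and> forced (\<lambda>i. U i \<omega>) (k + int (e * length w))" if "D \<le> d" for d
            using later[OF that] unfolding recent_success_def F by blast
        qed
        moreover have "k \<le> m" using b0 by (simp add: k_def mult_nonpos_nonneg)
        ultimately show "\<omega> \<in> E" using w unfolding E_def by blast
      qed
    qed
  qed
  ultimately have "prob E = 1" using prob_le_1[of E] by linarith
  thus ?thesis unfolding E_def by (simp only: theta_finite_iff)
qed

end
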